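(* Let $n,m$ be positive integers. (a) If $m\le n-2$, then the weighted forest $F$ consisting of a star $K_{1,m}$ all of whose edges have weight $1$ together with $n-m-1$ isolated vertices is the unique weighted forest in $\mathcal{F}(n,m)$ of minimum energy, and $\mathbb{E}(F)=2\sqrt{m}$. (b) If $m\ge n-1$, then the weighted star $S=K_{1,n-1}$ with total weight $m$ whose edge weights are as equal as possible (the unique minimum-energy tree in $\mathcal{T}(n,m)$) is also the unique weighted forest in $\mathcal{F}(n,m)$ of minimum energy.
   Context: $\mathcal{F}(n,m)$ (resp. $\mathcal{T}(n,m)$) denotes the set of forests (resp. trees) on $n$ vertices in which every edge has a positive integer weight and the sum of all edge weights equals $m$. The energy of a weighted graph $G$ is $\mathbb{E}(G)=\sum_i|\lambda_i|$, where $\lambda_i$ are the eigenvalues of the weighted adjacency matrix (the symmetric matrix whose $(i,j)$ entry is the weight of edge $ij$, or $0$ if there is no such edge). Positive integers $a_1,\dots,a_k$ with sum $m$ are "as equal as possible" if each $a_i$ equals $\lfloor m/k\rfloor$ or $\lfloor m/k\rfloor+1$. $K_{1,p}$ is the star on $p+1$ vertices. Uniqueness is as weighted graphs (up to isomorphism). *)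

theory Defs
  imports "Jordan_Normal_Form.Char_Poly"
begin

text \<open>
  A weighted graph on the vertex set \<open>{..<n}\<close> is given by its weight function: \<open>w i j\<close> is the weight
  of the edge \<open>ij\<close>, and \<open>w i j = 0\<close> means that there is no such edge. The number \<open>n\<close> of vertices is
  kept as a separate parameter, since isolated vertices are not visible in \<open>w\<close>.
\<close>

type_synonym wgraph = "nat \<Rightarrow> nat \<Rightarrow> nat"

definition weighted_graph :: "nat \<Rightarrow> wgraph \<Rightarrow> bool" where
  "weighted_graph n w \<longleftrightarrow>
     (\<forall>i j. w i j = w j i) \<and> (\<forall>i. w i i = 0) \<and> (\<forall>i j. w i j > 0 \<longrightarrow> i < n \<and> j < n)"

definition total_weight :: "nat \<Rightarrow> wgraph \<Rightarrow> nat" where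
  "total_weight n w = (\<Sum>j<n. \<Sum>i<j. w i j)"

definition graph_cycle :: "wgraph \<Rightarrow> nat list \<Rightarrow> bool" where
  "graph_cycle w vs \<longleftrightarrow> length vs \<ge> 3 \<and> distinct vs \<and>
     (\<forall>k < length vs. w (vs ! k) (vs ! (Suc k mod length vs)) > 0)"

definition graph_acyclic :: "wgraph \<Rightarrow> bool" where
  "graph_acyclic w \<longleftrightarrow> \<not> (\<exists>vs. graph_cycle w vs)"

definition graph_connected :: "nat \<Rightarrow> wgraph \<Rightarrow> bool" where
  "graph_connected n w \<longleftrightarrow> (\<forall>u<n. \<forall>v<n. (u, v) \<in> {(i, j). w i j > 0}\<^sup>*)"

definition forests :: "nat \<Rightarrow> nat \<Rightarrow> wgraph set" where
  "forests n m = {w. weighted_graph n w \<and> graph_acyclic w \<and> total_weight n w = m}"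

definition trees :: "nat \<Rightarrow> nat \<Rightarrow> wgraph set" where
  "trees n m = {w \<in> forests n m. graph_connected n w}"

definition wgraph_iso :: "nat \<Rightarrow> wgraph \<Rightarrow> wgraph \<Rightarrow> bool" where
  "wgraph_iso n v w \<longleftrightarrow>
     (\<exists>f. bij_betw f {..<n} {..<n} \<and> (\<forall>i<n. \<forall>j<n. w (f i) (f j) = v i j))"

definition adjacency_matrix :: "nat \<Rightarrow> wgraph \<Rightarrow> real mat" where
  "adjacency_matrix n w = mat n n (\<lambda>(i, j). real (w i j))"

text \<open>
  The eigenvalues are taken with multiplicity, as the multiset of complex roots of the
  characteristic polynomial.
\<close>

definition energy :: "nat \<Rightarrow> wgraph \<Rightarrow> real" where
  "energy n w =
     (\<Sum>x \<in># proots (char_poly (map_mat complex_of_real (adjacency_matrix n w))). cmod x)"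

definition unique_min_energy :: "nat \<Rightarrow> wgraph set \<Rightarrow> wgraph \<Rightarrow> bool" where
  "unique_min_energy n C w \<longleftrightarrow> w \<in> C \<and>
     (\<forall>v\<in>C. energy n w \<le> energy n v \<and> (energy n v = energy n w \<longrightarrow> wgraph_iso n v w))"

text \<open>
  The star with centre \<open>0\<close> and leaves \<open>1, \<dots>, k\<close>, where the edge to leaf \<open>i\<close> has weight \<open>a i\<close>.
  As a weighted graph on \<open>n > k\<close> vertices it has \<open>n - k - 1\<close> additional isolated vertices.
\<close>

definition weighted_star :: "nat \<Rightarrow> (nat \<Rightarrow> nat) \<Rightarrow> wgraph" where
  "weighted_star k a i j =
     (if i = 0 \<and> j \<in> {1..k} then a j else if j = 0 \<and> i \<in> {1..k} then a i else 0)"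

definition as_equal_as_possible :: "nat \<Rightarrow> nat \<Rightarrow> (nat \<Rightarrow> nat) \<Rightarrow> bool" where
  "as_equal_as_possible k m a \<longleftrightarrow> (\<Sum>i=1..k. a i) = m \<and>
     (\<forall>i\<in>{1..k}. a i > 0 \<and> (a i = m div k \<or> a i = m div k + 1))"

end

theory Submission
  imports Defs "Jordan_Normal_Form.Schur_Decomposition"
begin

text \<open>
  Let \<open>A\<close> be the adjacency matrix, \<open>\<mu>\<close> the sum of the squared edge weights and \<open>E\<close> the energy. As
  \<open>A\<close> has trace \<open>0\<close>, every eigenvalue satisfies \<open>\<bar>\<lambda>\<bar> \<le> E / 2\<close>, so that
  \<open>2 \<mu> = \<Sum>\<lambda>\<^sup>2 \<le> (E / 2) \<Sum>\<bar>\<lambda>\<bar> = E\<^sup>2 / 2\<close>, that is \<open>E \<ge> 2 \<surd>\<mu>\<close>. Equality forces \<open>\<lambda>\<^sup>3 = \<mu> \<lambda>\<close> for all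
  \<open>\<lambda>\<close>, hence the trace of \<open>(A\<^sup>3 - \<mu> A)\<^sup>2\<close> vanishes and \<open>A\<^sup>3 = \<mu> A\<close>. In a forest, comparing the
  entries of this equation at an edge shows that the edge meets all the others, so the forest is a
  star. Conversely stars satisfy \<open>A\<^sup>3 = \<mu> A\<close> and have energy \<open>2 \<surd>\<mu>\<close>.

  It remains to minimise \<open>\<mu>\<close>. With \<open>q = m div (n - 1)\<close>, every natural number \<open>x\<close> satisfies
  \<open>x\<^sup>2 + q (q + 1) \<ge> (2 q + 1) x\<close>, with equality only for \<open>x \<in> {q, q + 1}\<close>. Summing over the at
  most \<open>n - 1\<close> edges gives \<open>\<mu> + (n - 1) q (q + 1) \<ge> (2 q + 1) m\<close>, with equality exactly when the
  weights are as equal as possible.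
\<close>

section \<open>Traces of matrix powers as power sums of eigenvalues\<close>

lemma trace_mult_commute:
  fixes A B :: "'a :: comm_semiring_0 mat"
  assumes "A \<in> carrier_mat n n" "B \<in> carrier_mat n n"
  shows "(\<Sum>i<n. (A * B) $$ (i, i)) = (\<Sum>i<n. (B * A) $$ (i, i))"
proof -
  have "(\<Sum>i<n. (A * B) $$ (i, i)) = (\<Sum>i<n. \<Sum>j<n. A $$ (i, j) * B $$ (j, i))"
    using assms by (intro sum.cong) (auto simp: scalar_prod_def atLeast0LessThan)
  also have "\<dots> = (\<Sum>j<n. \<Sum>i<n. A $$ (i, j) * B $$ (j, i))"
    by (rule sum.swap)
  also have "\<dots> = (\<Sum>i<n. (B * A) $$ (i, i))"
    using assms by (intro sum.cong) (auto simp: scalar_prod_def atLeast0LessThan mult.commute)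
  finally show ?thesis .
qed

text \<open>The two claims go through one induction: the diagonal entry of the product collapses to
  a single term because of the zeros below the diagonal.\<close>

lemma upper_triangular_pow:
  fixes U :: "'a :: comm_semiring_1 mat"
  assumes U: "U \<in> carrier_mat n n" "upper_triangular U"
  shows "(\<forall>i<n. \<forall>j<i. (U ^\<^sub>m k) $$ (i, j) = 0) \<and> (\<forall>i<n. (U ^\<^sub>m k) $$ (i, i) = U $$ (i, i) ^ k)"
proof (induction k)
  case 0
  then show ?case using U by auto
next
  case (Suc k)
  have entry: "(U ^\<^sub>m Suc k) $$ (i, j) = (\<Sum>l<n. (U ^\<^sub>m k) $$ (i, l) * U $$ (l, j))"
    if "i < n" "j < n" for i j
    using that U by (auto simp: scalar_prod_def atLeast0LessThan)
  have U0: "U $$ (i, j) = 0" if "j < i" "i < n" for i j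
    using U that by auto
  have "(U ^\<^sub>m Suc k) $$ (i, j) = 0" if "i < n" "j < i" for i j
  proof -
    have "(U ^\<^sub>m k) $$ (i, l) * U $$ (l, j) = 0" if "l < n" for l
      using Suc U0[of j l] \<open>i < n\<close> \<open>j < i\<close> that by (cases "l < i") auto
    then show ?thesis using entry[of i j] that by simp
  qed
  moreover have "(U ^\<^sub>m Suc k) $$ (i, i) = U $$ (i, i) ^ Suc k" if "i < n" for i
  proof -
    have "(U ^\<^sub>m k) $$ (i, l) * U $$ (l, i) = (if l = i then U $$ (i, i) ^ Suc k else 0)"
      if "l < n" for l
      using Suc U0[of i l] \<open>i < n\<close> that by (cases "l < i"; cases "l = i") (auto simp: mult.commute)
    then show ?thesis using entry[of i i] that by simp
  qed
  ultimately show ?case by blast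
qed

text \<open>In a Schur decomposition \<open>A = P * U * Q\<close> the roots stand on the diagonal of
  \<open>U\<close>. Since \<open>Q * P\<close> is the identity, cyclicity of the trace reduces
  \<open>A ^\<^sub>m k\<close> to \<open>U ^\<^sub>m k\<close>.\<close>

lemma char_poly_roots_power_sums:
  fixes A :: "complex mat"
  assumes A: "A \<in> carrier_mat n n"
  obtains e :: "nat \<Rightarrow> complex" where
    "proots (char_poly A) = image_mset e (mset_set {..<n})"
    "\<And>k. (\<Sum>i<n. (A ^\<^sub>m k) $$ (i, i)) = (\<Sum>i<n. e i ^ k)"
    "\<And>i. i < n \<Longrightarrow> eigenvalue A (e i)"
proof -
  from char_poly_factorized[OF A] obtain es where
    cp: "char_poly A = (\<Prod>a\<leftarrow>es. [:- a, 1:])" and len: "length es = n" by blast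
  obtain U P Q where UPQ: "schur_decomposition A es = (U, P, Q)" by (cases "schur_decomposition A es")
  from schur_decomposition[OF A cp UPQ]
  have sim: "similar_mat_wit A U P Q" and ut: "upper_triangular U" and diag: "diag_mat U = es" by auto
  from similar_mat_witD2[OF A sim] have QP: "Q * P = 1\<^sub>m n" and
    U: "U \<in> carrier_mat n n" and P: "P \<in> carrier_mat n n" and Q: "Q \<in> carrier_mat n n" by auto
  define e where "e i = es ! i" for i
  have Uii: "U $$ (i, i) = e i" if "i < n" for i
    using that U diag unfolding e_def diag_mat_def by auto
  have "mset es = image_mset e (mset_set {..<n})"
    unfolding e_def using len
    by (metis atLeast0LessThan map_nth mset_map mset_upt)
  moreover have "proots (char_poly A) = mset es"
  proof -
    have "proots (char_poly A) = (\<Sum>p\<leftarrow>map (\<lambda>a. [:- a, 1:]) es. proots p)"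
      unfolding cp using proots_prod_list[of "map (\<lambda>a. [:- a, 1:]) es"] by force
    also have "\<dots> = mset es" by (induction es) auto
    finally show ?thesis .
  qed
  ultimately have "proots (char_poly A) = image_mset e (mset_set {..<n})" by simp
  moreover have "(\<Sum>i<n. (A ^\<^sub>m k) $$ (i, i)) = (\<Sum>i<n. e i ^ k)" for k
  proof -
    have Uk: "U ^\<^sub>m k \<in> carrier_mat n n" using U by simp
    have "A ^\<^sub>m k = P * (U ^\<^sub>m k * Q)"
      using similar_mat_wit_pow_id[OF sim, of k] P Q Uk by simp
    then have "(\<Sum>i<n. (A ^\<^sub>m k) $$ (i, i)) = (\<Sum>i<n. (U ^\<^sub>m k * Q * P) $$ (i, i))"
      using trace_mult_commute[of P n "U ^\<^sub>m k * Q"] P Q Uk by simp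
    also have "U ^\<^sub>m k * Q * P = U ^\<^sub>m k"
      using P Q Uk QP right_mult_one_mat[OF Uk] by simp
    finally show ?thesis using upper_triangular_pow[OF U ut, of k] Uii by simp
  qed
  moreover have "eigenvalue A (e i)" if "i < n" for i
    unfolding eigenvalue_root_char_poly[OF A] cp poly_prod_list
    using that len by (auto simp: prod_list_zero_iff e_def)
  ultimately show ?thesis using that by blast
qed

section \<open>The energy inequality for complex numbers with sum zero\<close>

text \<open>\<open>e i\<close> is minus the sum of the other terms, so its norm is at most the sum
  of their norms.\<close>

lemma norm_le_half_sum_norm:
  fixes e :: "'b \<Rightarrow> 'a :: real_normed_vector"
  assumes "finite I" "i \<in> I" "sum e I = 0"
  shows "norm (e i) \<le> (\<Sum>j\<in>I. norm (e j)) / 2"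
proof -
  have "e i = - sum e (I - {i})"
    using assms by (simp add: sum.remove[of I i] eq_neg_iff_add_eq_0)
  then have "norm (e i) \<le> (\<Sum>j\<in>I - {i}. norm (e j))"
    by (simp add: norm_sum)
  also have "\<dots> = (\<Sum>j\<in>I. norm (e j)) - norm (e i)"
    using assms by (simp add: sum.remove[of I i])
  finally show ?thesis by simp
qed

text \<open>As the \<open>e i\<close> are complex, \<open>2 * \<mu>\<close> is read as the sum of
  the \<open>Re ((e i)\<^sup>2)\<close>. This is at most the sum of the squared moduli, which the
  half-sum bound estimates by \<open>E\<^sup>2 / 2\<close>. In case of equality both estimates are
  sharp termwise: the first makes \<open>(e i)\<^sup>2\<close> real and nonnegative, the second
  makes \<open>cmod (e i)\<close> either \<open>0\<close> or \<open>E / 2\<close>.\<close>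

lemma
  fixes e :: "'b \<Rightarrow> complex"
  assumes I: "finite I" and s1: "sum e I = 0" and s2: "(\<Sum>i\<in>I. (e i)\<^sup>2) = of_real (2 * \<mu>)"
    and \<mu>: "\<mu> \<ge> 0"
  shows two_sqrt_le_sum_cmod: "2 * sqrt \<mu> \<le> (\<Sum>i\<in>I. cmod (e i))"
    and cube_eq_if_sum_cmod_eq: "(\<Sum>i\<in>I. cmod (e i)) = 2 * sqrt \<mu> \<Longrightarrow> i \<in> I \<Longrightarrow> e i ^ 3 = of_real \<mu> * e i"
proof -
  define E where "E = (\<Sum>i\<in>I. cmod (e i))"
  have E0: "E \<ge> 0" unfolding E_def by (intro sum_nonneg) auto
  have half: "(cmod (e i))\<^sup>2 \<le> E / 2 * cmod (e i)" if "i \<in> I" for i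
    unfolding power2_eq_square E_def
    by (intro mult_right_mono norm_le_half_sum_norm I s1 that) auto
  have re: "Re ((e i)\<^sup>2) \<le> (cmod (e i))\<^sup>2" for i
    using complex_Re_le_cmod[of "(e i)\<^sup>2"] by (simp add: norm_power)
  have sre: "(\<Sum>i\<in>I. Re ((e i)\<^sup>2)) = 2 * \<mu>"
    using arg_cong[OF s2, of Re] by (simp add: Re_sum)
  have shalf: "(\<Sum>i\<in>I. E / 2 * cmod (e i)) = E\<^sup>2 / 2"
    unfolding sum_distrib_left[symmetric] E_def[symmetric] by (simp add: power2_eq_square)
  have 1: "2 * \<mu> \<le> (\<Sum>i\<in>I. (cmod (e i))\<^sup>2)"
    unfolding sre[symmetric] by (intro sum_mono re)
  have 2: "(\<Sum>i\<in>I. (cmod (e i))\<^sup>2) \<le> E\<^sup>2 / 2"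
    unfolding shalf[symmetric] by (intro sum_mono half)
  from 1 2 have "4 * \<mu> \<le> E\<^sup>2" by simp
  then have "(2 * sqrt \<mu>)\<^sup>2 \<le> E\<^sup>2" using \<mu> by (simp add: power_mult_distrib)
  then show "2 * sqrt \<mu> \<le> (\<Sum>i\<in>I. cmod (e i))"
    unfolding E_def[symmetric] using E0 by (rule power2_le_imp_le)
  assume "(\<Sum>i\<in>I. cmod (e i)) = 2 * sqrt \<mu>" and i: "i \<in> I"
  then have E: "E = 2 * sqrt \<mu>" by (simp add: E_def)
  then have EE: "E\<^sup>2 / 2 = 2 * \<mu>" using \<mu> by (simp add: power_mult_distrib)
  have "(\<Sum>i\<in>I. (cmod (e i))\<^sup>2 - Re ((e i)\<^sup>2)) = 0"
    using 1 2 EE sre by (simp add: sum_subtractf)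
  then have r: "Re ((e i)\<^sup>2) = (cmod (e i))\<^sup>2"
    using i I re sum_nonneg_eq_0_iff[of I "\<lambda>i. (cmod (e i))\<^sup>2 - Re ((e i)\<^sup>2)"] by force
  have "(\<Sum>i\<in>I. E / 2 * cmod (e i) - (cmod (e i))\<^sup>2) = 0"
    using 1 2 EE shalf by (simp add: sum_subtractf)
  then have c: "(cmod (e i))\<^sup>2 = E / 2 * cmod (e i)"
    using i I half sum_nonneg_eq_0_iff[of I "\<lambda>i. E / 2 * cmod (e i) - (cmod (e i))\<^sup>2"] by force
  have "(e i)\<^sup>2 = of_real ((cmod (e i))\<^sup>2)"
  proof -
    have "(Re ((e i)\<^sup>2))\<^sup>2 + (Im ((e i)\<^sup>2))\<^sup>2 = (cmod ((e i)\<^sup>2))\<^sup>2"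
      by (rule cmod_power2[symmetric])
    then have "Im ((e i)\<^sup>2) = 0" using r by (simp add: norm_power)
    then show ?thesis using r by (simp add: complex_eq_iff del: of_real_power)
  qed
  moreover have "e i = 0 \<or> (cmod (e i))\<^sup>2 = \<mu>"
  proof (cases "e i = 0")
    case False
    then have "cmod (e i) = sqrt \<mu>" using c E by (simp add: power2_eq_square)
    then show ?thesis using \<mu> by simp
  qed simp
  ultimately show "e i ^ 3 = of_real \<mu> * e i"
    by (auto simp: power3_eq_cube power2_eq_square)
qed

text \<open>Each \<open>e i\<close> is \<open>0\<close> or has square \<open>\<mu>\<close>, so
  \<open>sqrt \<mu> * cmod (e i)\<close> equals \<open>(e i)\<^sup>2\<close>, whose sum is given by
  \<open>s2\<close>.\<close>

lemma sum_cmod_eq_two_sqrt: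
  fixes e :: "'b \<Rightarrow> complex"
  assumes s2: "(\<Sum>i\<in>I. (e i)\<^sup>2) = of_real (2 * \<mu>)" and \<mu>: "\<mu> > 0"
    and e3: "\<And>i. i \<in> I \<Longrightarrow> e i ^ 3 = of_real \<mu> * e i"
  shows "(\<Sum>i\<in>I. cmod (e i)) = 2 * sqrt \<mu>"
proof -
  have *: "sqrt \<mu> * cmod (e i) = Re ((e i)\<^sup>2)" if "i \<in> I" for i
  proof (cases "e i = 0")
    case False
    then have sq: "(e i)\<^sup>2 = of_real \<mu>"
      using e3[OF that] by (simp add: power3_eq_cube power2_eq_square)
    then have "(cmod (e i))\<^sup>2 = \<mu>" using \<mu> by (metis norm_power norm_of_real abs_of_pos)
    then have "cmod (e i) = sqrt \<mu>" by (metis norm_ge_zero real_sqrt_unique)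
    then show ?thesis using sq \<mu> by simp
  qed simp
  have "sqrt \<mu> * (\<Sum>i\<in>I. cmod (e i)) = (\<Sum>i\<in>I. Re ((e i)\<^sup>2))"
    unfolding sum_distrib_left by (intro sum.cong refl *)
  also have "\<dots> = Re (\<Sum>i\<in>I. (e i)\<^sup>2)" by (simp only: Re_sum)
  also have "\<dots> = sqrt \<mu> * (2 * sqrt \<mu>)" unfolding s2 using \<mu> by simp
  finally show ?thesis using \<mu> by simp
qed

section \<open>Weighted graphs and the cube of the adjacency matrix\<close>

text \<open>\<open>total_weight\<close> counts an edge once, a sum over all matrix entries counts it
  twice; this converts between them.\<close>

lemma sum_symmetric_square:
  fixes g :: "nat \<Rightarrow> nat \<Rightarrow> 'a :: comm_semiring_1"
  assumes "\<And>i j. g i j = g j i" "\<And>i. g i i = 0"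
  shows "(\<Sum>i<n. \<Sum>j<n. g i j) = 2 * (\<Sum>j<n. \<Sum>i<j. g i j)"
proof (induction n)
  case (Suc n)
  have "(\<Sum>i<Suc n. \<Sum>j<Suc n. g i j) = (\<Sum>i<n. \<Sum>j<n. g i j) + (\<Sum>i<n. g i n) + (\<Sum>j<n. g n j)"
    by (simp add: sum.distrib assms algebra_simps)
  also have "(\<Sum>j<n. g n j) = (\<Sum>i<n. g i n)"
    using assms by (intro sum.cong) auto
  finally show ?case using Suc by (simp add: distrib_left mult_2 ac_simps)
qed simp

text \<open>These are the entries of the cubed adjacency matrix, kept as natural numbers for the
  counting arguments in forests.\<close>

definition walk3 :: "nat \<Rightarrow> wgraph \<Rightarrow> wgraph" where
  "walk3 n w u v = (\<Sum>x<n. \<Sum>y<n. w u x * w x y * w y v)"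

text \<open>The quantity \<open>\<mu>\<close>, phrased through \<open>total_weight\<close> so that
  facts about sums over edges apply to the squared weights.\<close>

definition square_weight :: "nat \<Rightarrow> wgraph \<Rightarrow> nat" where
  "square_weight n w = total_weight n (\<lambda>i j. (w i j)\<^sup>2)"

lemma weighted_graphD:
  assumes "weighted_graph n w"
  shows "w i j = w j i" "w i i = 0" "w i j > 0 \<Longrightarrow> i < n" "w i j > 0 \<Longrightarrow> j < n"
  using assms unfolding weighted_graph_def by blast+

lemma sum_squares_eq_square_weight:
  assumes "weighted_graph n w"
  shows "(\<Sum>i<n. \<Sum>j<n. (w i j)\<^sup>2) = 2 * square_weight n w"
  unfolding square_weight_def total_weight_def
  by (rule sum_symmetric_square) (use weighted_graphD[OF assms] in auto)

lemma walk3_symmetric: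
  assumes "weighted_graph n w"
  shows "walk3 n w u v = walk3 n w v u"
proof -
  have "walk3 n w u v = (\<Sum>x<n. \<Sum>y<n. w v y * w y x * w x u)"
    unfolding walk3_def
    by (intro sum.cong refl) (simp add: weighted_graphD(1)[OF assms] mult_ac)
  also have "\<dots> = walk3 n w v u" unfolding walk3_def by (rule sum.swap)
  finally show ?thesis .
qed

text \<open>The bridge between spectrum and entries. The traces of \<open>A\<close> and
  \<open>A\<^sup>2\<close> feed the energy inequality; those of the second, fourth and sixth powers
  appear when \<open>(A\<^sup>3 - \<mu> A)\<^sup>2\<close> is expanded. The converse applies
  \<open>A\<^sup>3 = \<mu> A\<close> to an eigenvector.\<close>

lemma
  assumes w: "weighted_graph n w"
  shows energy_ge: "2 * sqrt (real (square_weight n w)) \<le> energy n w"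
    and walk3_eq_if_energy_eq: "energy n w = 2 * sqrt (real (square_weight n w)) \<Longrightarrow> u < n \<Longrightarrow> v < n \<Longrightarrow>
           walk3 n w u v = square_weight n w * w u v"
    and energy_eq_if_walk3_eq: "square_weight n w > 0 \<Longrightarrow>
           (\<And>u v. u < n \<Longrightarrow> v < n \<Longrightarrow> walk3 n w u v = square_weight n w * w u v) \<Longrightarrow>
           energy n w = 2 * sqrt (real (square_weight n w))"
proof -
  define A where "A = map_mat complex_of_real (adjacency_matrix n w)"
  define \<mu> where "\<mu> = square_weight n w"
  have A: "A \<in> carrier_mat n n" by (simp add: A_def adjacency_matrix_def)
  have Aij: "A $$ (i, j) = of_nat (w i j)" if "i < n" "j < n" for i j
    using that by (simp add: A_def adjacency_matrix_def)
  from char_poly_roots_power_sums[OF A] obtain e where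
    roots: "proots (char_poly A) = image_mset e (mset_set {..<n})" and
    tr: "\<And>k. (\<Sum>i<n. (A ^\<^sub>m k) $$ (i, i)) = (\<Sum>i<n. e i ^ k)" and
    ev: "\<And>i. i < n \<Longrightarrow> eigenvalue A (e i)" by metis
  have energy: "energy n w = (\<Sum>i<n. cmod (e i))"
    unfolding energy_def A_def[symmetric] roots by (simp add: sum_unfold_sum_mset multiset.map_comp comp_def)
  have mult: "(X * Y) $$ (i, j) = (\<Sum>l<n. X $$ (i, l) * Y $$ (l, j))"
    if "X \<in> carrier_mat n n" "Y \<in> carrier_mat n n" "i < n" "j < n" for X Y :: "complex mat" and i j
    using that by (simp add: scalar_prod_def atLeast0LessThan)
  have A1: "A ^\<^sub>m 1 = A" using A by simp
  have A2: "A ^\<^sub>m 2 = A * A" using A by (simp add: numeral_2_eq_2)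
  have A3: "A ^\<^sub>m 3 = A * A * A" using A by (simp add: numeral_3_eq_3)
  have A3c: "A ^\<^sub>m 3 \<in> carrier_mat n n" using A by simp
  have A4: "A ^\<^sub>m 4 = A ^\<^sub>m 3 * A" by (simp add: eval_nat_numeral)
  have A6: "A ^\<^sub>m 6 = A ^\<^sub>m 3 * A ^\<^sub>m 3"
  proof -
    have "A ^\<^sub>m 6 = A ^\<^sub>m 3 * A * A * A" by (simp add: eval_nat_numeral)
    also have "\<dots> = A ^\<^sub>m 3 * (A * A * A)"
      using assoc_mult_mat[OF A3c A A] assoc_mult_mat[OF A A A]
        assoc_mult_mat[OF A3c mult_carrier_mat[OF A A] A] by (simp only:)
    finally show ?thesis unfolding A3 .
  qed
  have A3ij: "(A ^\<^sub>m 3) $$ (i, j) = of_nat (walk3 n w i j)" if "i < n" "j < n" for i j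
  proof -
    have "(A ^\<^sub>m 3) $$ (i, j) = (\<Sum>y<n. \<Sum>x<n. of_nat (w i x * w x y * w y j))"
      unfolding A3 using that
      by (simp add: mult[OF mult_carrier_mat[OF A A] A] mult[OF A A] Aij sum_distrib_right
          del: assoc_mult_mat index_mult_mat)
    also have "\<dots> = of_nat (walk3 n w i j)"
      unfolding walk3_def of_nat_sum by (rule sum.swap)
    finally show ?thesis .
  qed
  note sym = weighted_graphD(1)[OF w]
  have t1: "(\<Sum>i<n. e i) = 0"
    using tr[of 1] A1 Aij weighted_graphD(2)[OF w] by simp
  \<comment> \<open>For symmetric matrices the trace of a product is the sum of the products of
    corresponding entries; this gives \<open>t2\<close>, \<open>t4\<close> and
    \<open>t6\<close>.\<close>
  have t2: "(\<Sum>i<n. (e i)\<^sup>2) = of_nat (\<Sum>i<n. \<Sum>j<n. (w i j)\<^sup>2)"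
    unfolding tr[of 2, symmetric] A2 of_nat_sum using A
    by (intro sum.cong refl) (simp add: mult Aij power2_eq_square sym del: index_mult_mat)
  have t4: "(\<Sum>i<n. e i ^ 4) = of_nat (\<Sum>i<n. \<Sum>j<n. walk3 n w i j * w i j)"
    unfolding tr[of 4, symmetric] A4 of_nat_sum using A A3c
    by (intro sum.cong refl) (simp add: mult Aij A3ij sym del: index_mult_mat)
  have t6: "(\<Sum>i<n. e i ^ 6) = of_nat (\<Sum>i<n. \<Sum>j<n. walk3 n w i j * walk3 n w i j)"
    unfolding tr[of 6, symmetric] A6 of_nat_sum using A3c walk3_symmetric[OF w]
    by (intro sum.cong refl) (simp add: mult A3ij del: index_mult_mat)
  have s2: "(\<Sum>i<n. (e i)\<^sup>2) = of_real (2 * real \<mu>)"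
    unfolding t2 \<mu>_def sum_squares_eq_square_weight[OF w] by simp
  show "2 * sqrt (real (square_weight n w)) \<le> energy n w"
    unfolding energy \<mu>_def[symmetric]
    by (rule two_sqrt_le_sum_cmod[OF _ t1 s2]) auto
  {
    assume "energy n w = 2 * sqrt (real (square_weight n w))" and u: "u < n" and v: "v < n"
    then have e3: "e i ^ 3 = of_real (real \<mu>) * e i" if "i < n" for i
      using cube_eq_if_sum_cmod_eq[OF _ t1 s2] that unfolding energy \<mu>_def[symmetric] by simp
    \<comment> \<open>\<open>d\<close> is the symmetric matrix \<open>A\<^sup>3 - \<mu> A\<close>; its squared entries sum to the trace of its square.\<close>
    define d where "d i j = int (walk3 n w i j) - int \<mu> * int (w i j)" for i j
    have "of_int (\<Sum>i<n. \<Sum>j<n. (d i j)\<^sup>2) =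
      (\<Sum>i<n. e i ^ 6) - 2 * of_nat \<mu> * (\<Sum>i<n. e i ^ 4) + (of_nat \<mu>)\<^sup>2 * (\<Sum>i<n. (e i)\<^sup>2)"
      unfolding t2 t4 t6 d_def
      by (simp add: power2_diff sum.distrib sum_subtractf sum_distrib_left power_mult_distrib
          power2_eq_square algebra_simps)
    also have "\<dots> = (\<Sum>i<n. (e i ^ 3 - of_nat \<mu> * e i)\<^sup>2)"
      by (simp add: power2_diff sum.distrib sum_subtractf sum_distrib_left power_mult_distrib
          eval_nat_numeral algebra_simps)
    also have "\<dots> = 0" using e3 by simp
    \<comment> \<open>Back in the integers, which are ordered, a sum of squares vanishes only
      termwise.\<close>
    finally have "(\<Sum>i<n. \<Sum>j<n. (d i j)\<^sup>2) = 0"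
      using of_int_eq_0_iff by blast
    then have "(\<Sum>j<n. (d u j)\<^sup>2) = 0"
      using u by (subst (asm) sum_nonneg_eq_0_iff) (auto intro: sum_nonneg)
    then have "(d u v)\<^sup>2 = 0"
      using v by (subst (asm) sum_nonneg_eq_0_iff) auto
    then have "int (walk3 n w u v) = int (\<mu> * w u v)" by (simp add: d_def)
    then show "walk3 n w u v = square_weight n w * w u v"
      unfolding \<mu>_def by (simp only: of_nat_eq_iff)
  }
  {
    assume pos: "square_weight n w > 0"
      and w3: "\<And>u v. u < n \<Longrightarrow> v < n \<Longrightarrow> walk3 n w u v = square_weight n w * w u v"
    have e3: "e i ^ 3 = of_real (real \<mu>) * e i" if "i < n" for i
    proof -
      from ev[OF that] obtain x where x: "eigenvector A x (e i)" unfolding eigenvalue_def by auto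
      then have xc: "x \<in> carrier_vec n" "x \<noteq> 0\<^sub>v n" and Ax: "A *\<^sub>v x = e i \<cdot>\<^sub>v x"
        using A unfolding eigenvector_def by auto
      \<comment> \<open>A nonzero coordinate of the eigenvector, to be cancelled at the end.\<close>
      obtain l where l: "l < n" "x $ l \<noteq> 0" using xc by (metis eq_vecI carrier_vecD index_zero_vec)
      have mv: "(X *\<^sub>v x) $ l = (\<Sum>j<n. X $$ (l, j) * x $ j)" if "X \<in> carrier_mat n n" for X
        using that xc l by (simp add: scalar_prod_def atLeast0LessThan)
      have "e i ^ 3 * x $ l = (A ^\<^sub>m 3 *\<^sub>v x) $ l"
        using eigenvector_pow[OF A x, of 3] xc l by simp
      also have "\<dots> = of_nat \<mu> * (A *\<^sub>v x) $ l"
        unfolding mv[OF A3c] mv[OF A] sum_distrib_left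
        using l by (intro sum.cong refl) (simp add: A3ij Aij w3 \<mu>_def)
      also have "\<dots> = of_nat \<mu> * e i * x $ l"
        unfolding Ax using xc l by simp
      finally show ?thesis using l by simp
    qed
    show "energy n w = 2 * sqrt (real (square_weight n w))"
      unfolding energy \<mu>_def[symmetric]
      by (rule sum_cmod_eq_two_sqrt[OF s2]) (use e3 pos in \<open>auto simp: \<mu>_def\<close>)
  }
qed

section \<open>Stars satisfy the cubic equation\<close>

text \<open>Isolated vertices are allowed, as the minimiser for \<open>m \<le> n - 2\<close> has
  them.\<close>

definition star_at :: "nat \<Rightarrow> wgraph \<Rightarrow> bool" where
  "star_at c w \<longleftrightarrow> (\<forall>i j. w i j > 0 \<longrightarrow> i = c \<or> j = c)"

lemma star_atD: "star_at c w \<Longrightarrow> w i j > 0 \<Longrightarrow> i = c \<or> j = c"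
  unfolding star_at_def by blast

text \<open>Every edge appears once in row \<open>c\<close> and once more in column \<open>c\<close>
  of the weight matrix.\<close>

lemma total_weight_star:
  assumes w: "weighted_graph n w" and c: "c < n"
    and star: "star_at c w"
  shows "total_weight n w = (\<Sum>x<n. w c x)"
proof -
  note wD = weighted_graphD[OF w]
  have row: "(\<Sum>j<n. w i j) = w i c" if "i \<noteq> c" for i
  proof -
    have "w i j = (if j = c then w i c else 0)" for j
      using star_atD[OF star, of i j] that by auto
    then have "(\<Sum>j<n. w i j) = (\<Sum>j<n. if j = c then w i c else 0)" by metis
    then show ?thesis using c by simp
  qed
  have "2 * total_weight n w = (\<Sum>i<n. \<Sum>j<n. w i j)"
    unfolding total_weight_def by (rule sum_symmetric_square[symmetric]) (use wD in auto)
  also have "\<dots> = (\<Sum>j<n. w c j) + (\<Sum>i\<in>{..<n} - {c}. \<Sum>j<n. w i j)"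
    using c by (simp add: sum.remove[of "{..<n}" c "\<lambda>i. \<Sum>j<n. w i j"])
  also have "(\<Sum>i\<in>{..<n} - {c}. \<Sum>j<n. w i j) = (\<Sum>i\<in>{..<n} - {c}. w c i)"
    using wD(1) row by (intro sum.cong) auto
  also have "\<dots> = (\<Sum>i<n. w c i)"
    using c wD(2)[of c] by (simp add: sum.remove[of "{..<n}" c])
  finally show ?thesis by simp
qed

lemma square_weight_star:
  assumes w: "weighted_graph n w" and c: "c < n"
    and star: "star_at c w"
  shows "square_weight n w = (\<Sum>x<n. (w c x)\<^sup>2)"
  unfolding square_weight_def
proof (rule total_weight_star[OF _ c])
  show "weighted_graph n (\<lambda>i j. (w i j)\<^sup>2)"
    using w unfolding weighted_graph_def by auto
qed (use star in \<open>auto simp: star_at_def\<close>)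

text \<open>A walk of length 3 from the centre goes out to a leaf, returns, and then takes its last
  edge, which contributes \<open>(w c x)\<^sup>2 * w c v\<close>. Between two vertices other than
  the centre there is no walk of odd length.\<close>

lemma walk3_star:
  assumes w: "weighted_graph n w" and c: "c < n"
    and star: "star_at c w"
    and "u < n" "v < n"
  shows "walk3 n w u v = square_weight n w * w u v"
proof -
  note wD = weighted_graphD[OF w]
  have z: "w i j = 0" if "i \<noteq> c" "j \<noteq> c" for i j using star_atD[OF star, of i j] that by auto
  have center: "walk3 n w c v = square_weight n w * w c v" for v
  proof -
    have "(\<Sum>y<n. w c x * w x y * w y v) = (w c x)\<^sup>2 * w c v" for x
    proof -
      have "w c x * w x y * w y v = (if y = c then (w c x)\<^sup>2 * w c v else 0)" for y
        using z[of x y] wD(2)[of c] wD(1)[of x c] by (cases "x = c") (auto simp: power2_eq_square)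
      then show ?thesis using c by simp
    qed
    then show ?thesis
      unfolding walk3_def square_weight_star[OF w c star] by (simp add: sum_distrib_right)
  qed
  show ?thesis
  proof (cases "u = c \<or> v = c")
    case True
    then show ?thesis
      using center walk3_symmetric[OF w] wD(1) by metis
  next
    case False
    have "w u x * w x y * w y v = 0" for x y
      using False z[of u x] z[of y v] wD(2)[of c] by (cases "x = c"; cases "y = c") auto
    then show ?thesis unfolding walk3_def using False z by simp
  qed
qed

section \<open>Forests satisfying the cubic equation are stars\<close>

lemma no_4_cycle:
  assumes "graph_acyclic w" "distinct [a, b, c, d]"
    "w a b > 0" "w b c > 0" "w c d > 0" "w d a > 0"
  shows False
proof -
  have "graph_cycle w [a, b, c, d]"
    unfolding graph_cycle_def
  proof (intro conjI allI impI)
    fix k assume "k < length [a, b, c, d]"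
    then have "k < 4" by simp
    then consider "k = 0" | "k = 1" | "k = 2" | "k = 3" by linarith
    then show "w ([a, b, c, d] ! k) ([a, b, c, d] ! (Suc k mod length [a, b, c, d])) > 0"
      using assms(3-) by cases simp_all
  qed (use assms(2) in simp_all)
  then show False using assms(1) unfolding graph_acyclic_def by blast
qed

lemma no_3_cycle:
  assumes "graph_acyclic w" "distinct [a, b, c]" "w a b > 0" "w b c > 0" "w c a > 0"
  shows False
proof -
  have "graph_cycle w [a, b, c]"
    unfolding graph_cycle_def
  proof (intro conjI allI impI)
    fix k assume "k < length [a, b, c]"
    then have "k < 3" by simp
    then consider "k = 0" | "k = 1" | "k = 2" by linarith
    then show "w ([a, b, c] ! k) ([a, b, c] ! (Suc k mod length [a, b, c])) > 0"
      using assms(3-) by cases simp_all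
  qed (use assms(2) in simp_all)
  then show False using assms(1) unfolding graph_acyclic_def by blast
qed

text \<open>A walk \<open>u x y v\<close> has \<open>y = u\<close> or \<open>x = v\<close>, as
  otherwise the edge \<open>uv\<close> closes it to a 4-cycle. The two kinds give the two sums on
  the right. The walk \<open>u v u v\<close> is of both kinds, hence the correction
  \<open>w u v ^ 3\<close>.\<close>

lemma walk3_edge_acyclic:
  assumes w: "weighted_graph n w" and ac: "graph_acyclic w" and uv: "w u v > 0"
  shows "walk3 n w u v + w u v ^ 3 = w u v * ((\<Sum>x<n. (w u x)\<^sup>2) + (\<Sum>y<n. (w v y)\<^sup>2))"
proof -
  note wD = weighted_graphD[OF w]
  have n: "u < n" "v < n" using wD uv by blast+
  have uv': "u \<noteq> v" using wD(2)[of u] uv by auto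
  have *: "w u x * w x y * w y v + (if x = v \<and> y = u then w u v ^ 3 else 0) =
      (if y = u then w u v * (w u x)\<^sup>2 else 0) + (if x = v then w u v * (w v y)\<^sup>2 else 0)" for x y
  proof (cases "y = u \<or> x = v")
    case True
    then show ?thesis
    proof
      assume "y = u"
      then show ?thesis
        using wD(1)[of v u] wD(1)[of x u] by (auto simp: power2_eq_square power3_eq_cube)
    next
      assume "x = v"
      moreover have "w y v = w v y" by (rule wD(1))
      ultimately show ?thesis
        using uv' by (cases "y = u") (auto simp: power2_eq_square power3_eq_cube)
    qed
  next
    case False
    have "w u x * w x y * w y v = 0"
    proof (rule ccontr)
      assume "w u x * w x y * w y v \<noteq> 0"
      then have p: "w u x > 0" "w x y > 0" "w y v > 0" by auto
      then have "u \<noteq> x" "x \<noteq> y" "y \<noteq> v" using wD(2) by auto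
      then show False
        using no_4_cycle[OF ac, of u x y v] p uv uv' False wD(1)[of u v] by auto
    qed
    then show ?thesis using False by auto
  qed
  have "walk3 n w u v + w u v ^ 3 =
      (\<Sum>x<n. \<Sum>y<n. w u x * w x y * w y v + (if x = v \<and> y = u then w u v ^ 3 else 0))"
  proof -
    have "(\<Sum>y<n. if x = v \<and> y = u then w u v ^ 3 else 0) = (if x = v then w u v ^ 3 else 0)" for x
      using n by (cases "x = v") auto
    then show ?thesis using n unfolding walk3_def by (simp add: sum.distrib)
  qed
  also have "\<dots> = (\<Sum>x<n. \<Sum>y<n. (if y = u then w u v * (w u x)\<^sup>2 else 0) +
      (if x = v then w u v * (w v y)\<^sup>2 else 0))"
    unfolding * ..
  also have "\<dots> = (\<Sum>x<n. w u v * (w u x)\<^sup>2) + (\<Sum>x<n. \<Sum>y<n. if x = v then w u v * (w v y)\<^sup>2 else 0)"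
    using n by (simp add: sum.distrib)
  also have "(\<Sum>x<n. \<Sum>y<n. if x = v then w u v * (w v y)\<^sup>2 else 0) = (\<Sum>y<n. w u v * (w v y)\<^sup>2)"
    using n by (subst sum.swap) simp
  finally show ?thesis by (simp add: sum_distrib_left distrib_left)
qed

text \<open>
  By the previous lemma the \<open>uv\<close> entry of \<open>A\<^sup>3 = \<mu> A\<close> says that the squared weights of the edges
  meeting \<open>uv\<close> already add up to \<open>\<mu>\<close>, the total over all edges.
\<close>

lemma edges_meet_if_walk3_eq:
  assumes w: "weighted_graph n w" and ac: "graph_acyclic w" and uv: "w u v > 0"
    and walk: "walk3 n w u v = square_weight n w * w u v" and xy: "w x y > 0"
  shows "x = u \<or> x = v \<or> y = u \<or> y = v"
proof (rule ccontr)
  assume disj: "\<not> ?thesis"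
  note wD = weighted_graphD[OF w]
  have n: "u < n" "v < n" "x < n" "y < n" using wD uv xy by blast+
  have uv': "u \<noteq> v" using wD(2)[of u] uv by auto
  define f where "f i j = (w i j)\<^sup>2" for i j
  define d where "d i = (\<Sum>j<n. f i j)" for i
  have fs: "f i j = f j i" and f0: "f i i = 0" for i j
    using wD unfolding f_def by auto
  have "w u v * (square_weight n w + f u v) = w u v * (d u + d v)"
    using walk3_edge_acyclic[OF w ac uv] walk
    unfolding d_def f_def by (simp add: power3_eq_cube power2_eq_square algebra_simps)
  then have eq: "square_weight n w + f u v = d u + d v" using uv by simp
  have fvu: "f v u = f u v" by (rule fs)
  \<comment> \<open>Rows and columns \<open>u\<close> and \<open>v\<close> of \<open>f\<close>
    overlap only at \<open>(u, v)\<close>, \<open>(v, u)\<close> and zero diagonal entries. An edge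
    \<open>xy\<close> disjoint from \<open>uv\<close> lies outside all of them and would add a
    further term.\<close>
  have pt: "((if i = u then f u j else 0) + (if i = v then f v j else 0) +
      (if j = u then f i u else 0) + (if j = v then f i v else 0) +
      (if i = x then if j = y then f x y else 0 else 0)) \<le>
      f i j + (if i = u then if j = v then f u v else 0 else 0) +
      (if i = v then if j = u then f u v else 0 else 0)" for i j
    using disj uv' f0 fvu by auto
  have pick: "(\<Sum>i<n. \<Sum>j<n. if i = a then g j else 0) = (\<Sum>j<n. g j)" if "a < n" for a and g :: "nat \<Rightarrow> nat"
    using that by (subst sum.swap) simp
  have d: "(\<Sum>i<n. f i a) = d a" for a
    unfolding d_def using fs by (intro sum.cong) auto
  have "(\<Sum>i<n. \<Sum>j<n. (if i = u then f u j else 0) + (if i = v then f v j else 0) +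
      (if j = u then f i u else 0) + (if j = v then f i v else 0) +
      (if i = x then if j = y then f x y else 0 else 0)) \<le>
      (\<Sum>i<n. \<Sum>j<n. f i j + (if i = u then if j = v then f u v else 0 else 0) +
      (if i = v then if j = u then f u v else 0 else 0))"
    by (intro sum_mono pt)
  then have "d u + d v + d u + d v + f x y \<le> 2 * square_weight n w + f u v + f u v"
    unfolding sum.distrib sum_squares_eq_square_weight[OF w, folded f_def]
    using n by (simp add: pick d d_def[symmetric])
  then have "f x y = 0" using eq by simp
  then show False using xy by (simp add: f_def)
qed

text \<open>Pairwise meeting edges form a star or a triangle. An edge avoiding \<open>u\<close> must
  meet \<open>uv\<close> in \<open>v\<close>, one avoiding \<open>v\<close> must meet it in
  \<open>u\<close>; as these two also meet, they close a triangle with \<open>uv\<close>.\<close>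

lemma acyclic_edges_meet_imp_star:
  assumes w: "weighted_graph n w" and ac: "graph_acyclic w" and uv: "w u v > 0"
    and meet: "\<forall>u v x y. w u v > 0 \<longrightarrow> w x y > 0 \<longrightarrow> x = u \<or> x = v \<or> y = u \<or> y = v"
  obtains c where "c < n" "star_at c w"
proof -
  note wD = weighted_graphD[OF w]
  have n: "u < n" "v < n" using wD uv by blast+
  have "star_at u w \<or> star_at v w"
  proof (rule ccontr)
    assume "\<not> ?thesis"
    then obtain a b c d where ab: "w a b > 0" "a \<noteq> u" "b \<noteq> u" and cd: "w c d > 0" "c \<noteq> v" "d \<noteq> v"
      unfolding star_at_def by blast
    have "\<exists>x. w v x > 0 \<and> x \<noteq> u"
      using meet[rule_format, OF uv ab(1)] ab wD(1)[of a b] by metis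
    then obtain x where x: "w v x > 0" "x \<noteq> u" by blast
    have "\<exists>y. w u y > 0 \<and> y \<noteq> v"
      using meet[rule_format, OF uv cd(1)] cd wD(1)[of c d] by metis
    then obtain y where y: "w u y > 0" "y \<noteq> v" by blast
    have ne: "u \<noteq> v" "x \<noteq> v" "y \<noteq> u" using wD(2) uv x y by auto
    then have "x = y" using meet[rule_format, OF x(1) y(1)] x y by auto
    then show False using no_3_cycle[OF ac, of u v x] uv x y ne wD(1)[of u x] by auto
  qed
  then show ?thesis using that n by blast
qed

section \<open>The number of edges of a forest\<close>

text \<open>A vertex at the end of a longest path has no second neighbour.\<close>

lemma acyclic_exists_leaf:
  assumes sym: "\<And>i j. w i j = w j i" and irr: "\<And>i. w i i = 0" and ac: "graph_acyclic w"
    and S: "finite S" "S \<noteq> {}"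
  obtains v where "v \<in> S" "card {x \<in> S. w v x > 0} \<le> 1"
proof -
  define path where "path vs \<longleftrightarrow> vs \<noteq> [] \<and> distinct vs \<and> set vs \<subseteq> S \<and>
    (\<forall>i. Suc i < length vs \<longrightarrow> w (vs ! i) (vs ! Suc i) > 0)" for vs
  from S obtain s where "s \<in> S" by blast
  then have "path [s]" unfolding path_def by auto
  moreover have "length vs < Suc (card S)" if "path vs" for vs
    using that S card_mono[of S "set vs"] distinct_card[of vs] unfolding path_def by simp
  ultimately obtain vs where vs: "path vs" and max: "\<And>us. path us \<Longrightarrow> length us \<le> length vs"
    using ex_has_greatest_nat[of path "[s]" length "Suc (card S)"] by (metis less_imp_le)
  \<comment> \<open>If \<open>vs\<close> has a single vertex, \<open>vs ! 1\<close> is unspecified,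
    but then the first vertex has no neighbour in \<open>S\<close> and the claim is vacuous.\<close>
  have "x = vs ! 1" if x: "x \<in> S" "w (vs ! 0) x > 0" for x
  proof (cases "x \<in> set vs")
    case False
    have "path (x # vs)"
      unfolding path_def
    proof (intro conjI allI impI)
      fix i assume "Suc i < length (x # vs)"
      then show "w ((x # vs) ! i) ((x # vs) ! Suc i) > 0"
        using vs x sym[of x "vs ! 0"] unfolding path_def by (cases i) auto
    qed (use vs x False in \<open>auto simp: path_def\<close>)
    from max[OF this] show ?thesis by simp
  next
    case True
    then obtain k where k: "k < length vs" "x = vs ! k" by (metis in_set_conv_nth)
    have "k \<noteq> 0" using x(2) k irr[of "vs ! 0"] by (cases k) auto
    show ?thesis
    proof (rule ccontr)
      assume "x \<noteq> vs ! 1"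
      with \<open>k \<noteq> 0\<close> k have k2: "k \<ge> 2" by (cases "k = 1") auto
      \<comment> \<open>The edge from \<open>vs ! 0\<close> to \<open>x = vs ! k\<close> closes the
        initial segment of the path; \<open>k2\<close> makes it long enough for a cycle.\<close>
      have "graph_cycle w (take (Suc k) vs)"
        unfolding graph_cycle_def
      proof (intro conjI allI impI)
        have len: "length (take (Suc k) vs) = Suc k" using k by simp
        fix i assume i: "i < length (take (Suc k) vs)"
        show "w (take (Suc k) vs ! i) (take (Suc k) vs ! (Suc i mod length (take (Suc k) vs))) > 0"
        proof (cases "i = k")
          case True
          then show ?thesis unfolding len using k x sym[of "vs ! k" "vs ! 0"] by simp
        next
          case False
          then show ?thesis unfolding len using i k vs unfolding path_def by simp
        qed
      qed (use k k2 vs in \<open>auto simp: path_def\<close>)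
      then show False using ac unfolding graph_acyclic_def by blast
    qed
  qed
  then have "{x \<in> S. w (vs ! 0) x > 0} \<subseteq> {vs ! 1}" by blast
  then have "card {x \<in> S. w (vs ! 0) x > 0} \<le> 1"
    using card_mono[of "{vs ! 1}"] by simp
  moreover have "vs ! 0 \<in> S" using vs unfolding path_def by (cases vs) auto
  ultimately show ?thesis using that by blast
qed

text \<open>Induction on the vertex set, deleting a leaf and with it at most one edge. The graph
  \<open>w\<close> stays fixed while \<open>S\<close> shrinks, so acyclicity is inherited for free.
  The double sum counts every edge twice.\<close>

lemma acyclic_edge_bound_set:
  assumes sym: "\<And>i j. w i j = w j i" and irr: "\<And>i. w i i = 0" and ac: "graph_acyclic w"
    and "finite S" "S \<noteq> {}"
  shows "(\<Sum>i\<in>S. \<Sum>j\<in>S. of_bool (w i j > 0)) + 2 \<le> 2 * card S"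
  using assms(4,5)
proof (induction "card S" arbitrary: S)
  case (Suc k)
  from acyclic_exists_leaf[OF sym irr ac Suc.prems] obtain v where
    v: "v \<in> S" and leaf: "card {x \<in> S. w v x > 0} \<le> 1" by blast
  define T where "T = S - {v}"
  have T: "finite T" "S = insert v T" "v \<notin> T" "card T = k"
    using v Suc by (auto simp: T_def)
  have "(\<Sum>x\<in>T. of_bool (w v x > 0)) = card {x \<in> T. w v x > 0}"
    using T by (simp add: sum_of_bool_eq Int_def)
  also have "\<dots> \<le> 1"
  proof -
    have "{x \<in> T. w v x > 0} \<subseteq> {x \<in> S. w v x > 0}" using T by auto
    then have "card {x \<in> T. w v x > 0} \<le> card {x \<in> S. w v x > 0}"
      using Suc.prems by (intro card_mono) auto
    then show ?thesis using leaf by linarith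
  qed
  finally have deg: "(\<Sum>x\<in>T. of_bool (w v x > 0)) \<le> (1 :: nat)" by simp
  have deg': "(\<Sum>x\<in>T. of_bool (w x v > 0)) = (\<Sum>x\<in>T. of_bool (w v x > 0) :: nat)"
    using sym by metis
  have split: "(\<Sum>i\<in>S. \<Sum>j\<in>S. of_bool (w i j > 0)) =
      (\<Sum>i\<in>T. \<Sum>j\<in>T. of_bool (w i j > 0)) + 2 * (\<Sum>x\<in>T. of_bool (w v x > 0) :: nat)"
    using T irr by (simp add: sum.distrib deg' del: sum_of_bool_eq)
  show ?case
  proof (cases "T = {}")
    case True
    then show ?thesis using split Suc.hyps(2) by simp
  next
    case False
    from Suc.hyps(1)[OF T(4)[symmetric] T(1) False] show ?thesis
      using split deg T(4) Suc.hyps(2) by simp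
  qed
qed simp

lemma forest_edge_bound:
  assumes w: "weighted_graph n w" and ac: "graph_acyclic w" and n: "n \<ge> 1"
  shows "total_weight n (\<lambda>i j. of_bool (w i j > 0)) \<le> n - 1"
proof -
  note wD = weighted_graphD[OF w]
  have "2 * total_weight n (\<lambda>i j. of_bool (w i j > 0)) = (\<Sum>i<n. \<Sum>j<n. of_bool (w i j > 0))"
    unfolding total_weight_def
    by (rule sum_symmetric_square[symmetric]) (use wD(1) in \<open>auto simp: wD(2)\<close>)
  moreover have "(\<Sum>i<n. \<Sum>j<n. of_bool (w i j > 0)) + 2 \<le> 2 * card {..<n}"
    using wD(1,2) ac n by (intro acyclic_edge_bound_set) (auto simp: lessThan_empty_iff)
  ultimately show ?thesis by simp
qed

section \<open>Minimising the sum of the squared weights\<close>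

text \<open>The difference of the two sides is a product of two consecutive integers. Geometrically,
  the line is the chord of the parabola between \<open>q\<close> and \<open>q + 1\<close>.\<close>

lemma
  fixes x q :: nat
  shows nat_square_ge_chord: "(2 * q + 1) * x \<le> x\<^sup>2 + q * (q + 1)"
    and nat_square_eq_chord_iff: "(2 * q + 1) * x = x\<^sup>2 + q * (q + 1) \<longleftrightarrow> x = q \<or> x = q + 1"
proof -
  have id: "int (x\<^sup>2 + q * (q + 1)) - int ((2 * q + 1) * x) = (int x - int q) * (int x - int (q + 1))"
    by (simp add: algebra_simps power2_eq_square)
  have "0 \<le> (int x - int q) * (int x - int (q + 1))"
    by (cases "x \<le> q") (auto intro: mult_nonpos_nonpos mult_nonneg_nonneg)
  with id show "(2 * q + 1) * x \<le> x\<^sup>2 + q * (q + 1)" by linarith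
  have "(2 * q + 1) * x = x\<^sup>2 + q * (q + 1) \<longleftrightarrow> (int x - int q) * (int x - int (q + 1)) = 0"
    using id by linarith
  then show "(2 * q + 1) * x = x\<^sup>2 + q * (q + 1) \<longleftrightarrow> x = q \<or> x = q + 1" by auto
qed

text \<open>The chord inequality is summed with the constant \<open>q * (q + 1)\<close> charged to
  actual edges only, of which there are at most \<open>n - 1\<close>.\<close>

lemma forest_square_weight_bound:
  assumes w: "weighted_graph n w" and ac: "graph_acyclic w" and n: "n \<ge> 1"
  shows "(2 * q + 1) * total_weight n w \<le> square_weight n w + (n - 1) * (q * (q + 1))"
proof -
  have "(2 * q + 1) * w i j \<le> (w i j)\<^sup>2 + of_bool (w i j > 0) * (q * (q + 1))" for i j
    using nat_square_ge_chord[of q "w i j"] by (cases "w i j = 0") auto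
  then have "(2 * q + 1) * total_weight n w \<le>
      square_weight n w + total_weight n (\<lambda>i j. of_bool (w i j > 0)) * (q * (q + 1))"
    unfolding square_weight_def total_weight_def sum_distrib_left sum_distrib_right sum.distrib[symmetric]
    by (intro sum_mono)
  also have "\<dots> \<le> square_weight n w + (n - 1) * (q * (q + 1))"
    using forest_edge_bound[OF assms] by (intro add_mono mult_right_mono) auto
  finally show ?thesis .
qed

section \<open>Minimality and uniqueness of the star\<close>

text \<open>Size and sum determine how often each of the two values is taken, so bijections between
  the level sets can be glued.\<close>

lemma bij_betw_two_valued:
  fixes f :: "'a \<Rightarrow> nat" and g :: "'b \<Rightarrow> nat"
  assumes fin: "finite A" "finite B" and card: "card A = card B" and sums: "sum f A = sum g B"
    and f: "\<And>x. x \<in> A \<Longrightarrow> f x = q \<or> f x = q + 1" and g: "\<And>x. x \<in> B \<Longrightarrow> g x = q \<or> g x = q + 1"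
  obtains h where "bij_betw h A B" "\<And>x. x \<in> A \<Longrightarrow> g (h x) = f x"
proof -
  have count: "sum k C = q * card C + card {x \<in> C. k x = q + 1}"
    if "finite C" "\<And>x. x \<in> C \<Longrightarrow> k x = q \<or> k x = q + 1" for k :: "'c \<Rightarrow> nat" and C
  proof -
    have "sum k C = (\<Sum>x\<in>C. q + of_bool (k x = q + 1))"
      using that(2) by (intro sum.cong) auto
    then show ?thesis using that(1) by (simp add: sum.distrib sum_of_bool_eq Int_def)
  qed
  have eq1: "card {x \<in> A. f x = q + 1} = card {x \<in> B. g x = q + 1}"
    using count[of A f] count[of B g] fin f g sums card by simp
  have AB: "A = {x \<in> A. f x = q} \<union> {x \<in> A. f x = q + 1}" "B = {x \<in> B. g x = q} \<union> {x \<in> B. g x = q + 1}"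
    using f g by blast+
  have "card {x \<in> A. f x = q} + card {x \<in> A. f x = q + 1} = card A"
    "card {x \<in> B. g x = q} + card {x \<in> B. g x = q + 1} = card B"
    using fin by (subst card_Un_disjoint[symmetric]; use AB in auto)+
  then have eq0: "card {x \<in> A. f x = q} = card {x \<in> B. g x = q}" using eq1 card by simp
  from eq0 eq1 fin obtain h0 h1 where
    h0: "bij_betw h0 {x \<in> A. f x = q} {x \<in> B. g x = q}" and
    h1: "bij_betw h1 {x \<in> A. f x = q + 1} {x \<in> B. g x = q + 1}"
    using finite_same_card_bij[of "{x \<in> A. f x = q}" "{x \<in> B. g x = q}"]
      finite_same_card_bij[of "{x \<in> A. f x = q + 1}" "{x \<in> B. g x = q + 1}"] by auto
  define h where "h x = (if x \<in> {x \<in> A. f x = q} then h0 x else h1 x)" for x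
  have "bij_betw h A B"
    unfolding h_def using bij_betw_disjoint_Un[OF h0 h1] AB by (auto simp: disjoint_iff)
  moreover have "g (h x) = f x" if "x \<in> A" for x
    using f[OF that] that bij_betwE[OF h0] bij_betwE[OF h1] unfolding h_def by auto
  ultimately show ?thesis using that by blast
qed

text \<open>The first two edges of a cycle share only \<open>vs ! 1\<close>, so this is
  \<open>c\<close>, and the third edge avoids it. In a triangle that edge ends at
  \<open>vs ! 0\<close>, hence the index \<open>3 mod length vs\<close>.\<close>

lemma graph_acyclic_star:
  assumes star: "star_at c w"
  shows "graph_acyclic w"
  unfolding graph_acyclic_def
proof
  assume "\<exists>vs. graph_cycle w vs"
  then obtain vs where len: "length vs \<ge> 3" and dist: "distinct vs"
    and edge: "\<And>k. k < length vs \<Longrightarrow> w (vs ! k) (vs ! (Suc k mod length vs)) > 0"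
    unfolding graph_cycle_def by blast
  have c: "vs ! k = c \<or> vs ! (Suc k mod length vs) = c" if "k < length vs" for k
    using star_atD[OF star edge[OF that]] .
  have ne: "vs ! i \<noteq> vs ! j" if "i < length vs" "j < length vs" "i \<noteq> j" for i j
    using that dist nth_eq_iff_index_eq by blast
  have "vs \<noteq> []" using len by auto
  then have c0: "vs ! 0 = c \<or> vs ! 1 = c" and c1: "vs ! 1 = c \<or> vs ! 2 = c"
    using c[of 0] c[of 1] len mod_less[of 1 "length vs"] mod_less[of 2 "length vs"]
    by (auto simp: numeral_2_eq_2)
  have "vs ! 0 \<noteq> vs ! 2" by (rule ne) (use len in auto)
  then have "vs ! 1 = c" using c0 c1 by auto
  moreover have "vs ! 2 = c \<or> vs ! (3 mod length vs) = c"
    using c[of 2] len by (simp add: eval_nat_numeral)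
  moreover have "3 mod length vs < length vs" "3 mod length vs \<noteq> 1"
    using len by (cases "length vs = 3"; auto)+
  ultimately show False using ne[of 1 2] ne[of 1 "3 mod length vs"] len by auto
qed

text \<open>The common core of both parts. Weights may be \<open>0\<close> when
  \<open>q = 0\<close>, which covers stars with isolated vertices.\<close>

lemma weighted_star_unique_min_energy:
  assumes k: "k \<ge> 1" and m: "m \<ge> 1" and sum: "(\<Sum>i=1..k. a i) = m"
    and a: "\<And>i. i \<in> {1..k} \<Longrightarrow> a i = q \<or> a i = q + 1"
  shows "unique_min_energy (Suc k) (forests (Suc k) m) (weighted_star k a)"
    and "energy (Suc k) (weighted_star k a) = 2 * sqrt (real (\<Sum>i=1..k. (a i)\<^sup>2))"
proof -
  define n where "n = Suc k"
  define s where "s = weighted_star k a"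
  have s: "weighted_graph n s" unfolding weighted_graph_def s_def weighted_star_def n_def by auto
  have star: "star_at 0 s"
    unfolding star_at_def s_def weighted_star_def by auto
  have set: "{..<n} - {0} = {1..k}" unfolding n_def by auto
  have s0: "s 0 0 = 0" "\<And>i. i \<in> {1..k} \<Longrightarrow> s 0 i = a i" unfolding s_def weighted_star_def by auto
  have tot: "total_weight n s = m"
    using total_weight_star[OF s _ star] set s0 sum
    by (simp add: n_def sum.remove[of "{..<Suc k}" 0] del: sum.lessThan_Suc)
  have sq: "square_weight n s = (\<Sum>i=1..k. (a i)\<^sup>2)"
    using square_weight_star[OF s _ star] set s0
    by (simp add: n_def sum.remove[of "{..<Suc k}" 0] del: sum.lessThan_Suc)
  \<comment> \<open>All weights lie where chord and parabola meet, so the star attains the lower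
    bound for forests.\<close>
  have chord: "square_weight n s + k * (q * (q + 1)) = (2 * q + 1) * m"
  proof -
    have "(\<Sum>i=1..k. (2 * q + 1) * a i) = (\<Sum>i=1..k. (a i)\<^sup>2 + q * (q + 1))"
      by (intro sum.cong refl) (use a nat_square_eq_chord_iff in blast)
    then show ?thesis unfolding sq sum[symmetric] sum_distrib_left by (simp add: sum.distrib)
  qed
  have sF: "s \<in> forests n m"
    unfolding forests_def using s tot graph_acyclic_star[OF star] by blast
  have "square_weight n s > 0"
  proof (rule ccontr)
    assume "\<not> ?thesis"
    then have "\<forall>i\<in>{1..k}. a i = 0" unfolding sq by auto
    then show False using sum m by simp
  qed
  then have es: "energy n s = 2 * sqrt (real (square_weight n s))"
    by (rule energy_eq_if_walk3_eq[OF s]) (rule walk3_star[OF s _ star], auto simp: n_def)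
  then show "energy (Suc k) (weighted_star k a) = 2 * sqrt (real (\<Sum>i=1..k. (a i)\<^sup>2))"
    using sq unfolding n_def s_def by simp
  have "energy n s \<le> energy n v \<and> (energy n v = energy n s \<longrightarrow> wgraph_iso n v s)"
    if "v \<in> forests n m" for v
  proof -
    from that have v: "weighted_graph n v" and ac: "graph_acyclic v" and vm: "total_weight n v = m"
      unfolding forests_def by auto
    note vD = weighted_graphD[OF v]
    have le: "square_weight n s \<le> square_weight n v"
      using forest_square_weight_bound[OF v ac, of q] chord vm unfolding n_def by simp
    then have le': "2 * sqrt (real (square_weight n s)) \<le> 2 * sqrt (real (square_weight n v))" by simp
    have "wgraph_iso n v s" if eq: "energy n v = energy n s"
    proof -
      \<comment> \<open>The inequalities between \<open>s\<close> and \<open>v\<close> collapse: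
        \<open>v\<close> has the same \<open>square_weight\<close> and attains equality in
        \<open>energy_ge\<close>.\<close>
      have "2 * sqrt (real (square_weight n v)) \<le> 2 * sqrt (real (square_weight n s))"
        using energy_ge[OF v] eq es by simp
      then have sqv: "square_weight n v = square_weight n s" using le by simp
      then have ev: "energy n v = 2 * sqrt (real (square_weight n v))" using eq es by simp
      have "\<exists>x y. v x y > 0"
      proof (rule ccontr)
        assume "\<not> ?thesis"
        then show False using vm m unfolding total_weight_def by simp
      qed
      then obtain x y where xy: "v x y > 0" by blast
      have "\<forall>u u' x y. v u u' > 0 \<longrightarrow> v x y > 0 \<longrightarrow> x = u \<or> x = u' \<or> y = u \<or> y = u'"
        using edges_meet_if_walk3_eq[OF v ac] walk3_eq_if_energy_eq[OF v ev] vD by metis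
      then obtain c where c: "c < n" and vstar: "star_at c v"
        by (rule acyclic_edges_meet_imp_star[OF v ac xy])
      define D where "D = {..<n} - {c}"
      have D: "finite D" "card D = k" using c unfolding D_def n_def by auto
      have vsum: "sum (v c) D = m"
        using total_weight_star[OF v c vstar] vm c vD(2)[of c]
        unfolding D_def by (simp add: sum.remove[of "{..<n}" c])
      have "square_weight n v = (\<Sum>x\<in>D. (v c x)\<^sup>2)"
        using square_weight_star[OF v c vstar] c vD(2)[of c]
        unfolding D_def by (simp add: sum.remove[of "{..<n}" c])
      then have "(\<Sum>x\<in>D. (2 * q + 1) * v c x) = (\<Sum>x\<in>D. (v c x)\<^sup>2 + q * (q + 1))"
        using chord sqv D vsum by (simp add: sum.distrib sum_distrib_left[symmetric])
      \<comment> \<open>The sums agree and the chord inequality holds termwise, so it is sharp in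
        every term.\<close>
      then have "(2 * q + 1) * v c x = (v c x)\<^sup>2 + q * (q + 1)" if "x \<in> D" for x
        by (rule sum_mono_inv[OF _ _ that D(1)]) (use nat_square_ge_chord in blast)
      then have two: "v c x = q \<or> v c x = q + 1" if "x \<in> D" for x
        using nat_square_eq_chord_iff that by blast
      obtain h where h: "bij_betw h D {1..k}" "\<And>x. x \<in> D \<Longrightarrow> a (h x) = v c x"
        using bij_betw_two_valued[of D "{1..k}" "v c" a q] D vsum sum two a by auto
      \<comment> \<open>\<open>h\<close> matches the leaves by weight; \<open>f\<close> also sends
        the centre \<open>c\<close> of \<open>v\<close> to the centre \<open>0\<close> of
        \<open>s\<close>.\<close>
      define f where "f = h(c := 0)"
      have "bij_betw f D {1..k}"
        using h(1) by (subst bij_betw_cong[of D f h]) (auto simp: f_def D_def)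
      then have "bij_betw f (insert c D) (insert 0 {1..k})"
        using bij_betw_combine[of f "{c}" "{0}" D "{1..k}"] by (auto simp: f_def bij_betw_def)
      moreover have "insert c D = {..<n}" "insert 0 {1..k} = {..<n}"
        using c unfolding D_def n_def by auto
      ultimately have "bij_betw f {..<n} {..<n}" by simp
      moreover have "s (f i) (f j) = v i j" if ij: "i < n" "j < n" for i j
      proof -
        have hD: "h x \<in> {1..k}" if "x \<in> D" for x using bij_betwE[OF h(1)] that by blast
        have hc: "s 0 (h x) = v c x" "s (h x) 0 = v c x" if "x \<in> D" for x
          using s0(2)[OF hD[OF that]] h(2)[OF that] weighted_graphD(1)[OF s, of "h x" 0] by auto
        consider "i = c" "j = c" | "i = c" "j \<in> D" | "j = c" "i \<in> D" | "i \<in> D" "j \<in> D"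
          using ij unfolding D_def by blast
        then show ?thesis
        proof cases
          case 3
          then show ?thesis using hc[of i] vD(1)[of i c] by (auto simp: f_def D_def)
        next
          case 4
          then have "s (h i) (h j) = 0" "v i j = 0"
            using star_atD[OF star, of "h i" "h j"] star_atD[OF vstar, of i j] hD[of i] hD[of j] by (auto simp: D_def)
          then show ?thesis using 4 by (auto simp: f_def D_def)
        qed (use hc s0 vD(2)[of c] in \<open>auto simp: f_def D_def\<close>)
      qed
      ultimately show ?thesis unfolding wgraph_iso_def by blast
    qed
    then show ?thesis using energy_ge[OF v] le' es by linarith
  qed
  then show "unique_min_energy (Suc k) (forests (Suc k) m) (weighted_star k a)"
    unfolding unique_min_energy_def using sF unfolding n_def s_def by blast
qed

lemma graph_connected_weighted_star:
  assumes "\<And>i. i \<in> {1..k} \<Longrightarrow> a i > 0"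
  shows "graph_connected (Suc k) (weighted_star k a)"
  unfolding graph_connected_def
proof (intro allI impI)
  fix u v assume u: "u < Suc k" and v: "v < Suc k"
  let ?R = "{(i, j). weighted_star k a i j > 0}"
  have "(u, 0) \<in> ?R\<^sup>*"
    using u assms[of u] by (cases "u = 0") (auto intro!: r_into_rtrancl simp: weighted_star_def)
  moreover have "(0, v) \<in> ?R\<^sup>*"
    using v assms[of v] by (cases "v = 0") (auto intro!: r_into_rtrancl simp: weighted_star_def)
  ultimately show "(u, v) \<in> ?R\<^sup>*" by (rule rtrancl_trans)
qed

lemma ex_as_equal_as_possible:
  assumes "k \<ge> 1" "k \<le> m"
  shows "\<exists>a. as_equal_as_possible k m a"
proof -
  \<comment> \<open>The remainder is handed out to the first \<open>m mod k\<close> leaves;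
    \<open>k \<le> m\<close> keeps all weights positive.\<close>
  define a where "a i = m div k + of_bool (i \<le> m mod k)" for i
  have "m mod k < k" using assms by simp
  then have "{1..k} \<inter> {i. i \<le> m mod k} = {1..m mod k}" by auto
  then have "(\<Sum>i=1..k. a i) = k * (m div k) + m mod k"
    unfolding a_def by (simp add: sum.distrib sum_of_bool_eq)
  moreover have "m div k > 0" using assms by (simp add: div_greater_zero_iff)
  ultimately have "as_equal_as_possible k m a"
    unfolding as_equal_as_possible_def a_def by auto
  then show ?thesis by blast
qed

theorem theorem3:
  fixes n m :: nat
  assumes "n \<ge> 1" and "m \<ge> 1"
  shows "(m + 2 \<le> n \<longrightarrow>
            unique_min_energy n (forests n m) (weighted_star m (\<lambda>_. 1)) \<and>
            energy n (weighted_star m (\<lambda>_. 1)) = 2 * sqrt (real m)) \<and>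
         (n - 1 \<le> m \<longrightarrow>
            (n \<ge> 2 \<longrightarrow> (\<exists>a. as_equal_as_possible (n - 1) m a)) \<and>
            (\<forall>a. as_equal_as_possible (n - 1) m a \<longrightarrow>
               unique_min_energy n (trees n m) (weighted_star (n - 1) a) \<and>
               unique_min_energy n (forests n m) (weighted_star (n - 1) a)))"
proof (intro conjI impI allI)
  \<comment> \<open>Padding the unit star with zero weights to \<open>n - 1\<close> leaves turns it into the case \<open>m div (n - 1) = 0\<close>.\<close>
  assume mn: "m + 2 \<le> n"
  define a :: "nat \<Rightarrow> nat" where "a i = of_bool (i \<le> m)" for i
  have star: "weighted_star m (\<lambda>_. 1) = weighted_star (n - 1) a"
    using mn by (intro ext) (auto simp: weighted_star_def a_def)
  have "{1..n - 1} \<inter> {i. i \<le> m} = {1..m}" using mn by auto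
  then have sum: "(\<Sum>i=1..n - 1. a i) = m" by (simp add: a_def sum_of_bool_eq)
  \<comment> \<open>Weights \<open>0\<close> and \<open>1\<close> equal their squares.\<close>
  have sq: "(\<Sum>i=1..n - 1. (a i)\<^sup>2) = m"
    using sum by (simp add: a_def power2_eq_square flip: of_bool_conj)
  have n: "n - 1 \<ge> 1" "Suc (n - 1) = n" using mn by auto
  note min = weighted_star_unique_min_energy[of "n - 1" m a 0, OF n(1) assms(2) sum, unfolded n(2) sq]
  show "unique_min_energy n (forests n m) (weighted_star m (\<lambda>_. 1))"
    unfolding star by (rule min(1)) (simp add: a_def)
  show "energy n (weighted_star m (\<lambda>_. 1)) = 2 * sqrt (real m)"
    unfolding star by (rule min(2)) (simp add: a_def)
next
  assume "n - 1 \<le> m" "n \<ge> 2"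
  then show "\<exists>a. as_equal_as_possible (n - 1) m a"
    by (intro ex_as_equal_as_possible) auto
next
  fix a
  assume a: "as_equal_as_possible (n - 1) m a"
  \<comment> \<open>For \<open>n = 1\<close> the weights would have the empty sum \<open>0\<close>,
    contradicting \<open>m \<ge> 1\<close>.\<close>
  have n: "n - 1 \<ge> 1" "Suc (n - 1) = n"
    using a assms unfolding as_equal_as_possible_def by (cases "n = 1"; auto)+
  have forest: "unique_min_energy n (forests n m) (weighted_star (n - 1) a)"
    using weighted_star_unique_min_energy(1)[of "n - 1" m a "m div (n - 1)"] n assms(2) a
    unfolding as_equal_as_possible_def by simp
  moreover have "graph_connected n (weighted_star (n - 1) a)"
    using graph_connected_weighted_star[of "n - 1" a] n a unfolding as_equal_as_possible_def by simp
  \<comment> \<open>The star is itself a tree, so minimality and uniqueness pass from forests to the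
    subset of trees.\<close>
  ultimately show "unique_min_energy n (trees n m) (weighted_star (n - 1) a)"
    unfolding unique_min_energy_def trees_def by blast
  show "unique_min_energy n (forests n m) (weighted_star (n - 1) a)" by (rule forest)
qed

end
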